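(* Let $r:[0,\infty)\to\mathbb R^2\cong\mathbb C$ be a solution of $$\ddot r=(1-|\dot r|^2)\dot r-r,$$ and let $\phi$ denote the angle from $r$ to $\dot r$, measured counterclockwise. If $0<\phi<\pi$ at some instant, then $r(t)$ converges to a limit cycle $\mathrm r_+(t)=e^{i\theta_*}e^{it}$ for some phase angle $\theta_*$. If $-\pi<\phi<0$ at some instant, then $r(t)$ converges to a limit cycle $\mathrm r_-(t)=e^{i\theta_*}e^{-it}$ for some phase angle $\theta_*$. The limit cycles $\mathrm r_+$ and $\mathrm r_-$ are stable.
   Context: Planar vectors are identified with complex numbers. The angle $\phi$ is taken in $(-\pi,\pi]$ and is defined when $r\ne0$ and $\dot r\neq 0$. Convergence of $r(t)$ to $\mathrm r_\pm(t)$ means $r(t)-\mathrm r_\pm(t)\to0$ as $t\to\infty$. Stability refers to stability of the periodic orbits $(\mathrm r_\pm,\dot{\mathrm r}_\pm)$ in the phase space of pairs $(r,\dot r)$. *)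

theory Defs
  imports "HOL-Analysis.Analysis"
begin

(* The derivative is taken relative to the time domain I, hence one-sided at its end points. *)
definition velocity :: "real set \<Rightarrow> (real \<Rightarrow> complex) \<Rightarrow> real \<Rightarrow> complex" where
  "velocity I r t = vector_derivative r (at t within I)"

definition solution :: "real set \<Rightarrow> (real \<Rightarrow> complex) \<Rightarrow> bool" where
  "solution I r \<longleftrightarrow> (\<forall>t\<in>I.
     (r has_vector_derivative velocity I r t) (at t within I) \<and>
     (velocity I r has_vector_derivative
        ((1 - (norm (velocity I r t))\<^sup>2) *\<^sub>R velocity I r t - r t)) (at t within I))"

definition state :: "real set \<Rightarrow> (real \<Rightarrow> complex) \<Rightarrow> real \<Rightarrow> complex \<times> complex" where
  "state I r t = (r t, velocity I r t)"

(* Counterclockwise angle from z to w, in the range (-pi, pi]; meaningful only for nonzero z, w. *)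
definition angle_from_to :: "complex \<Rightarrow> complex \<Rightarrow> real" where
  "angle_from_to z w = Arg (w / z)"

definition r_plus :: "real \<Rightarrow> real \<Rightarrow> complex" where
  "r_plus \<theta> t = cis \<theta> * cis t"

definition r_minus :: "real \<Rightarrow> real \<Rightarrow> complex" where
  "r_minus \<theta> t = cis \<theta> * cis (- t)"

definition periodic_solution :: "(real \<Rightarrow> complex) \<Rightarrow> bool" where
  "periodic_solution p \<longleftrightarrow>
     solution UNIV p \<and> \<not> p constant_on UNIV \<and> (\<exists>T>0. \<forall>t. p (t + T) = p t)"

definition orbit :: "(real \<Rightarrow> complex) \<Rightarrow> (complex \<times> complex) set" where
  "orbit p = range (state UNIV p)"

(* Isolated closed trajectory: no other closed trajectory enters some neighbourhood of it. *)
definition limit_cycle :: "(real \<Rightarrow> complex) \<Rightarrow> bool" where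
  "limit_cycle p \<longleftrightarrow> periodic_solution p \<and>
     (\<exists>\<epsilon>>0. \<forall>q. periodic_solution q \<longrightarrow>
        (\<exists>t. infdist (state UNIV q t) (orbit p) < \<epsilon>) \<longrightarrow> orbit q = orbit p)"

(* Quantifying over solutions on all compact intervals [0, T] covers global solutions without
   presupposing that a solution starting near the orbit extends to [0, \<infinity>). *)
definition orbitally_stable :: "(real \<Rightarrow> complex) \<Rightarrow> bool" where
  "orbitally_stable p \<longleftrightarrow> (\<forall>\<epsilon>>0. \<exists>\<delta>>0. \<forall>T>0. \<forall>r.
     solution {0..T} r \<longrightarrow> infdist (state {0..T} r 0) (orbit p) < \<delta> \<longrightarrow>
     (\<forall>t\<in>{0..T}. infdist (state {0..T} r t) (orbit p) < \<epsilon>))"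

definition orbitally_attracting :: "(real \<Rightarrow> complex) \<Rightarrow> bool" where
  "orbitally_attracting p \<longleftrightarrow> (\<exists>\<delta>>0. \<forall>r.
     solution {0..} r \<longrightarrow> infdist (state {0..} r 0) (orbit p) < \<delta> \<longrightarrow>
     ((\<lambda>t. infdist (state {0..} r t) (orbit p)) \<longlongrightarrow> 0) at_top)"

(* Asymptotic orbital stability: both Lyapunov stability of the orbit in phase space and
   attraction of nearby trajectories. *)
definition stable_limit_cycle :: "(real \<Rightarrow> complex) \<Rightarrow> bool" where
  "stable_limit_cycle p \<longleftrightarrow>
     limit_cycle p \<and> orbitally_stable p \<and> orbitally_attracting p"

end

theory Submission
  imports Defs
begin

text \<open>
  Write \<open>a = |r|^2\<close>, \<open>b = |v|^2\<close> and \<open>c = r \<bullet> v\<close> for a solution with velocity \<open>v\<close>, let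
  \<open>s = 1\<close> or \<open>s = -1\<close> select the sense of rotation, and let \<open>L = s (r \<times> v)\<close> be the signed
  angular momentum; in the proofs \<open>s\<close> is any real number with \<open>s * s = 1\<close>.
  From \<open>L' = (1 - b) L\<close> the sign of \<open>L\<close>, which is \<open>s\<close> times the sign of the sine of the angle
  from \<open>r\<close> to \<open>v\<close>, never changes. On the region \<open>L > 0\<close> the function
  \<open>gap = a + b - 2 - 2 ln L = |v - s i r|^2 + 2 (L - 1 - ln L)\<close>
  is nonnegative, vanishes exactly on the circle \<open>{(z, s i z). |z| = 1}\<close> traced by the limit cycle,
  and satisfies \<open>gap' = -2 (b - 1)^2 \<le> 0\<close>. Comparing the gap with the distance to that circle
  (\<open>near_phase_circle\<close>, \<open>infdist_phase_circle_le\<close>) gives Lyapunov stability at once.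

  The dissipation degenerates where \<open>b = 1\<close>. It is made definite by a cross term:
  \<open>W = gap + \<epsilon> ((b - 1) c + c (a - b) / 4)\<close> satisfies
  \<open>W' \<le> - (\<epsilon> / 8) ((b - 1)^2 + c^2 + (a - b)^2)\<close> on a given sublevel set of the gap if \<open>\<epsilon>\<close> is
  small. There the gap, \<open>W\<close> and this quadratic expression are mutually comparable, so the gap
  decays exponentially (\<open>gap_exponential_decay\<close>).

  Exponential decay also fixes the phase: \<open>u(t) = r(t) e^(- i s t)\<close> has
  \<open>|u'| = |v - s i r| \<le> sqrt gap\<close>, which is integrable, so \<open>u\<close> converges; its limit has modulus one
  because the gap tends to zero (\<open>convergence_to_rotation\<close>).
  Finally, along a periodic solution with \<open>L > 0\<close> somewhere the gap is periodic and tends to zero,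
  hence it is zero and the orbit is the circle (\<open>periodic_trajectory_orbit\<close>). So the circle is
  isolated among closed trajectories.
\<close>

section \<open>Elementary inequalities\<close>

text \<open>
  Gronwall's inequality on \<open>{0..T}\<close> with one-sided derivatives at the end points. The case
  \<open>k = 0\<close> says that a function with nonpositive derivative does not increase.
\<close>

lemma exponential_decay:
  fixes f f' :: "real \<Rightarrow> real"
  assumes T: "0 \<le> T"
    and f: "\<And>t. t \<in> {0..T} \<Longrightarrow> (f has_real_derivative f' t) (at t within {0..T})"
    and le: "\<And>t. t \<in> {0..T} \<Longrightarrow> f' t \<le> - k * f t"
  shows "f T \<le> f 0 * exp (- k * T)"
proof (cases "T = 0")
  case False
  define g where "g t = f t * exp (k * t)" for t
  have g: "(g has_derivative (\<lambda>h. (f' t + k * f t) * exp (k * t) * h)) (at t within {0..T})"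
    if "t \<in> {0..T}" for t
    unfolding g_def has_field_derivative_def[symmetric]
    by (rule derivative_eq_intros f[OF that] refl | simp add: algebra_simps)+
  obtain x where x: "x \<in> {0<..<T}" "g T - g 0 = (f' x + k * f x) * exp (k * x) * (T - 0)"
    using mvt_simple[of 0 T g "\<lambda>t h. (f' t + k * f t) * exp (k * t) * h"] g T False by auto
  have "f' x + k * f x \<le> 0" using le[of x] x(1) by auto
  hence "(f' x + k * f x) * exp (k * x) * (T - 0) \<le> 0" using T
    by (simp add: mult_nonpos_nonneg)
  hence "f T * exp (k * T) \<le> f 0" using x(2) by (simp add: g_def)
  thus ?thesis by (simp add: exp_minus field_simps)
qed simp

lemma ln_defect_bounds:
  fixes L :: real
  assumes "0 < L"
  shows "(sqrt L - 1)\<^sup>2 \<le> L - 1 - ln L" "L - 1 - ln L \<le> (L - 1)\<^sup>2 / L"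
proof -
  have "ln L = 2 * ln (sqrt L)" using assms by (simp add: ln_sqrt)
  also have "\<dots> \<le> 2 * (sqrt L - 1)" using ln_le_minus_one[of "sqrt L"] assms by simp
  finally show "(sqrt L - 1)\<^sup>2 \<le> L - 1 - ln L"
    using assms by (simp add: power2_eq_square algebra_simps)
  have "- ln L \<le> 1 / L - 1" using ln_le_minus_one[of "1 / L"] assms by (simp add: ln_div)
  thus "L - 1 - ln L \<le> (L - 1)\<^sup>2 / L"
    using assms by (simp add: power2_eq_square field_simps)
qed

lemma power2_sum3_le:
  fixes x y z :: real
  shows "(x + y + z)\<^sup>2 \<le> 3 * (x\<^sup>2 + y\<^sup>2 + z\<^sup>2)"
proof -
  have "0 \<le> (x - y)\<^sup>2 + (y - z)\<^sup>2 + (x - z)\<^sup>2" by simp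
  thus ?thesis by (simp add: power2_eq_square algebra_simps)
qed

lemma weighted_sum3_le:
  fixes x y z A B C K :: real
  assumes "\<bar>A\<bar> \<le> K" "\<bar>B\<bar> \<le> K" "\<bar>C\<bar> \<le> K"
  shows "(A * x + B * y + C * z)\<^sup>2 \<le> 3 * K\<^sup>2 * (x\<^sup>2 + y\<^sup>2 + z\<^sup>2)"
proof -
  have *: "(A * x)\<^sup>2 \<le> K\<^sup>2 * x\<^sup>2" if "\<bar>A\<bar> \<le> K" for A x :: real
    unfolding power_mult_distrib
    by (rule mult_right_mono) (use that in \<open>auto intro: power2_le_iff_abs_le[THEN iffD2]\<close>)
  show ?thesis using power2_sum3_le[of "A * x" "B * y" "C * z"] *[OF assms(1), of x]
      *[OF assms(2), of y] *[OF assms(3), of z] by (simp add: algebra_simps)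
qed

text \<open>
  The defect from \<open>a = b = L = 1\<close>, \<open>c = 0\<close>, where \<open>a * b = c^2 + L^2\<close>, measured by the gap or by a
  quadratic form. The logarithm is controlled by \<open>(L - 1)^2\<close>, and \<open>L - 1\<close> and \<open>b - 1\<close> determine each
  other up to \<open>c\<close> and \<open>a - b\<close> by the identity
  \<open>(b - 1) (b + 1) = (L - 1) (L + 1) + c^2 - b (a - b)\<close>.
\<close>

lemma gap_equivalent_quadratic:
  fixes K l :: real
  assumes K: "1 \<le> K" and l: "0 < l"
  obtains m M where "0 < m" "0 < M"
    "\<And>a b c L :: real. \<lbrakk>0 \<le> a; a \<le> K; 0 \<le> b; b \<le> K; \<bar>c\<bar> \<le> K; l \<le> L; L \<le> K; a * b = c\<^sup>2 + L\<^sup>2\<rbrakk>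
       \<Longrightarrow> m * ((b - 1)\<^sup>2 + c\<^sup>2 + (a - b)\<^sup>2) \<le> a + b - 2 - 2 * ln L \<and>
          a + b - 2 - 2 * ln L \<le> M * ((b - 1)\<^sup>2 + c\<^sup>2 + (a - b)\<^sup>2)"
proof -
  define C where "C = 3 * (K + 1)\<^sup>2"
  have C: "C \<ge> 12" unfolding C_def using power_mono[of 2 "K+1" 2] K by simp
  define B where "B = C * (9 * K + 1) + 4 * K"
  have B: "B > 0" using C K by (simp add: B_def add_pos_pos)
  define M where "M = 1 / l + 2 * C / l"
  have M: "M > 0" using C l by (simp add: M_def add_pos_pos)
  have "1 / B * ((b - 1)\<^sup>2 + c\<^sup>2 + (a - b)\<^sup>2) \<le> a + b - 2 - 2 * ln L \<and>
          a + b - 2 - 2 * ln L \<le> M * ((b - 1)\<^sup>2 + c\<^sup>2 + (a - b)\<^sup>2)"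
    if h: "0 \<le> a" "a \<le> K" "0 \<le> b" "b \<le> K" "\<bar>c\<bar> \<le> K" "l \<le> L" "L \<le> K" "a * b = c\<^sup>2 + L\<^sup>2"
    for a b c L :: real
  proof -
    define N where "N = a + b - 2 * L"
    define Y where "Y = a + b - 2 - 2 * ln L"
    have L: "0 < L" using h l by simp
    have Y: "Y = N + 2 * (L - 1 - ln L)" by (simp add: Y_def N_def)
    have N1: "N * (a + b + 2 * L) = (a - b)\<^sup>2 + 4 * c\<^sup>2"
      using h(8) by (simp add: N_def power2_eq_square algebra_simps)
    have "(2 * L)\<^sup>2 \<le> (a + b)\<^sup>2"
    proof -
      have "(a + b)\<^sup>2 - (2 * L)\<^sup>2 = (a - b)\<^sup>2 + 4 * c\<^sup>2"
        using h(8) by (simp add: power2_eq_square algebra_simps)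
      moreover have "(a - b)\<^sup>2 + 4 * c\<^sup>2 \<ge> 0" by simp
      ultimately show ?thesis by linarith
    qed
    hence N0: "N \<ge> 0" using power2_le_imp_le[of "2 * L" "a + b"] h(1,3) by (simp add: N_def)
    have 1: "(a - b)\<^sup>2 + 4 * c\<^sup>2 \<le> 4 * K * N"
      unfolding N1[symmetric] using mult_left_mono[of "a + b + 2 * L" "4 * K" N] h N0
      by (simp add: algebra_simps)
    have 2: "4 * l * N \<le> (a - b)\<^sup>2 + 4 * c\<^sup>2"
      unfolding N1[symmetric] using mult_left_mono[of "4 * l" "a + b + 2 * L" N] h N0
      by (simp add: algebra_simps N_def)
    define S where "S = (sqrt L - 1)\<^sup>2"
    have S: "S \<le> L - 1 - ln L" "L - 1 - ln L \<le> (L - 1)\<^sup>2 / L" "0 \<le> S"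
      using ln_defect_bounds[OF L] by (auto simp: S_def)
    have "(L - 1)\<^sup>2 = S * (sqrt L + 1)\<^sup>2"
      unfolding S_def power_mult_distrib[symmetric] using L by (simp add: algebra_simps)
    also have "(sqrt L + 1)\<^sup>2 \<le> 2 * (L + 1)" using L sum_squares_ge_zero[of "sqrt L - 1" 0]
      by (simp add: power2_eq_square algebra_simps)
    finally have "(L - 1)\<^sup>2 \<le> S * (2 * (L + 1))" using S(3) by (simp add: mult_left_mono)
    also have "\<dots> \<le> S * (2 * (K + 1))" using S(3) h by (intro mult_left_mono) auto
    also have "\<dots> \<le> (K + 1) * Y"
    proof -
      have "2 * S \<le> Y" using Y S(1) N0 by argo
      from mult_left_mono[OF this, of "K+1"] K show ?thesis by (simp add: algebra_simps)
    qed
    finally have 3: "(L - 1)\<^sup>2 \<le> (K + 1) * Y" .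
    have id: "(b - 1) * (b + 1) = (L + 1) * (L - 1) + c * c + (- b) * (a - b)"
      using h(8) by (simp add: power2_eq_square algebra_simps)
    have NY: "N \<le> Y" "0 \<le> Y" using Y S(1,3) N0 by argo+
    have xc: "(a - b)\<^sup>2 + 4 * c\<^sup>2 \<le> 4 * K * Y"
      using 1 mult_left_mono[OF NY(1), of "4 * K"] K by linarith
    have 4: "(b - 1)\<^sup>2 \<le> C * ((L - 1)\<^sup>2 + c\<^sup>2 + (a - b)\<^sup>2)"
    proof -
      have "(b - 1)\<^sup>2 * 1 \<le> (b - 1)\<^sup>2 * (b + 1)\<^sup>2" using h(3)
        by (intro mult_left_mono one_le_power) auto
      also have "\<dots> = ((L + 1) * (L - 1) + c * c + (- b) * (a - b))\<^sup>2"
        by (simp only: id power_mult_distrib[symmetric])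
      also have "\<dots> \<le> C * ((L - 1)\<^sup>2 + c\<^sup>2 + (a - b)\<^sup>2)"
        unfolding C_def using h L by (intro weighted_sum3_le) auto
      finally show ?thesis by simp
    qed
    have 5: "(L - 1)\<^sup>2 \<le> C * ((b - 1)\<^sup>2 + c\<^sup>2 + (a - b)\<^sup>2)"
    proof -
      have "(L - 1)\<^sup>2 * 1 \<le> (L - 1)\<^sup>2 * (L + 1)\<^sup>2" using L
        by (intro mult_left_mono one_le_power) auto
      also have "\<dots> = ((b + 1) * (b - 1) + (- c) * c + b * (a - b))\<^sup>2"
        using id by (simp add: power_mult_distrib[symmetric] algebra_simps)
      also have "\<dots> \<le> C * ((b - 1)\<^sup>2 + c\<^sup>2 + (a - b)\<^sup>2)"
        unfolding C_def using h L by (intro weighted_sum3_le) auto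
      finally show ?thesis by simp
    qed
    have sq: "0 \<le> (a - b)\<^sup>2" "0 \<le> c\<^sup>2" "0 \<le> (b - 1)\<^sup>2" by auto
    have "(L - 1)\<^sup>2 + c\<^sup>2 + (a - b)\<^sup>2 \<le> (9 * K + 1) * Y"
    proof -
      have "0 \<le> K * Y" using K NY(2) by simp
      moreover have "(K + 1) * Y = K * Y + Y" "(9 * K + 1) * Y = 9 * (K * Y) + Y"
        "4 * K * Y = 4 * (K * Y)" by (simp_all add: algebra_simps)
      ultimately show ?thesis using xc sq 3 NY(2) by (smt (verit))
    qed
    hence mid: "C * ((L - 1)\<^sup>2 + c\<^sup>2 + (a - b)\<^sup>2) \<le> C * ((9 * K + 1) * Y)"
      using C by (intro mult_left_mono) auto
    have "(b - 1)\<^sup>2 + c\<^sup>2 + (a - b)\<^sup>2 \<le> B * Y"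
    proof -
      have "B * Y = C * ((9 * K + 1) * Y) + 4 * K * Y" by (simp add: B_def algebra_simps)
      thus ?thesis using 4 xc sq mid by (smt (verit))
    qed
    hence low: "1 / B * ((b - 1)\<^sup>2 + c\<^sup>2 + (a - b)\<^sup>2) \<le> Y" using B by (simp add: field_simps)
    define Q where "Q = (b - 1)\<^sup>2 + c\<^sup>2 + (a - b)\<^sup>2"
    have "4 * l * N = 4 * (N * l)" by simp
    hence "N * l \<le> Q" using 2 sq unfolding Q_def by (smt (verit))
    hence "N \<le> Q / l" using l by (simp add: field_simps)
    moreover have "(L - 1)\<^sup>2 / L \<le> C * Q / l"
      using 5 h(6) l L C unfolding Q_def
      by (intro frac_le) auto
    ultimately have "Y \<le> Q / l + 2 * (C * Q / l)" using Y S(2) by argo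
    hence "Y \<le> M * Q" unfolding M_def by (simp add: algebra_simps)
    thus ?thesis using low unfolding Y_def Q_def by simp
  qed
  thus thesis using that[of "1 / B" M] B M by auto
qed

section \<open>Angular momentum and the Lyapunov function\<close>

text \<open>
  A phase-space trajectory: position \<open>r\<close> and velocity \<open>v\<close> as a solution of the first-order system.
  Keeping \<open>v\<close> as a separate argument allows restriction to smaller time domains, whereas
  \<open>velocity I r\<close> depends on \<open>I\<close>.
\<close>

definition trajectory :: "real set \<Rightarrow> (real \<Rightarrow> complex) \<Rightarrow> (real \<Rightarrow> complex) \<Rightarrow> bool" where
  "trajectory I r v \<longleftrightarrow> (\<forall>t\<in>I. (r has_vector_derivative v t) (at t within I) \<and>
     (v has_vector_derivative ((1 - (norm (v t))\<^sup>2) *\<^sub>R v t - r t)) (at t within I))"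

text \<open>
  The angular momentum \<open>z \<times> w\<close> of position \<open>z\<close> and velocity \<open>w\<close>, counted positive in the sense of
  rotation \<open>s\<close> (\<open>1\<close> for counterclockwise, \<open>-1\<close> for clockwise).
\<close>

definition ang_mom :: "real \<Rightarrow> complex \<Rightarrow> complex \<Rightarrow> real" where
  "ang_mom s z w = s * Im (cnj z * w)"

text \<open>
  The Lyapunov function, normalized to vanish on the limit cycle. It is used only where the
  angular momentum is positive.
\<close>

definition gap :: "real \<Rightarrow> complex \<Rightarrow> complex \<Rightarrow> real" where
  "gap s z w = (norm z)\<^sup>2 + (norm w)\<^sup>2 - 2 - 2 * ln (ang_mom s z w)"

lemma ang_mom_eq: "ang_mom s z w = s * (Re z * Im w - Im z * Re w)"
  by (simp add: ang_mom_def)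

lemma solution_iff_trajectory: "solution I r \<longleftrightarrow> trajectory I r (velocity I r)"
  by (simp add: solution_def trajectory_def)

lemma trajectory_subset: "trajectory I r v \<Longrightarrow> J \<subseteq> I \<Longrightarrow> trajectory J r v"
  unfolding trajectory_def by (meson has_vector_derivative_within_subset subsetD)

lemma lagrange_identity:
  assumes "s * s = 1"
  shows "(norm z)\<^sup>2 * (norm w)\<^sup>2 = (z \<bullet> w)\<^sup>2 + (ang_mom s z w)\<^sup>2"
proof -
  have "(ang_mom s z w)\<^sup>2 = s * s * (Im (cnj z * w))\<^sup>2"
    by (simp add: ang_mom_def power2_eq_square)
  thus ?thesis using assms unfolding cmod_power2 inner_complex_def
    by (simp add: power2_eq_square algebra_simps)
qed

lemma norm_defect:
  assumes "s * s = 1"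
  shows "(norm (w - s *\<^sub>R (\<i> * z)))\<^sup>2 = (norm z)\<^sup>2 + (norm w)\<^sup>2 - 2 * ang_mom s z w"
proof -
  have "(norm (w - s *\<^sub>R (\<i> * z)))\<^sup>2 = (s * s) * (norm z)\<^sup>2 + (norm w)\<^sup>2 - 2 * ang_mom s z w"
    unfolding cmod_power2 ang_mom_def by (simp add: power2_eq_square algebra_simps)
  thus ?thesis using assms by simp
qed

lemma gap_eq:
  assumes "s * s = 1"
  shows "gap s z w = (norm (w - s *\<^sub>R (\<i> * z)))\<^sup>2 + 2 * (ang_mom s z w - 1 - ln (ang_mom s z w))"
  unfolding norm_defect[OF assms] gap_def by simp

lemma trajectory_derivatives:
  assumes "trajectory I r v" "t \<in> I"
  shows "((\<lambda>t. (norm (r t))\<^sup>2) has_real_derivative 2 * (r t \<bullet> v t)) (at t within I)"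
    and "((\<lambda>t. (norm (v t))\<^sup>2) has_real_derivative
            2 * (1 - (norm (v t))\<^sup>2) * (norm (v t))\<^sup>2 - 2 * (r t \<bullet> v t)) (at t within I)"
    and "((\<lambda>t. r t \<bullet> v t) has_real_derivative
            (norm (v t))\<^sup>2 + (1 - (norm (v t))\<^sup>2) * (r t \<bullet> v t) - (norm (r t))\<^sup>2) (at t within I)"
    and "((\<lambda>t. ang_mom s (r t) (v t)) has_real_derivative
            (1 - (norm (v t))\<^sup>2) * ang_mom s (r t) (v t)) (at t within I)"
proof -
  define A where "A = (1 - (norm (v t))\<^sup>2) *\<^sub>R v t - r t"
  have r: "(r has_vector_derivative v t) (at t within I)"
    and v: "(v has_vector_derivative A) (at t within I)"
    using assms by (auto simp: trajectory_def A_def)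
  have 1: "((\<lambda>t. Re (r t)) has_real_derivative Re (v t)) (at t within I)"
    and 2: "((\<lambda>t. Im (r t)) has_real_derivative Im (v t)) (at t within I)"
    and 3: "((\<lambda>t. Re (v t)) has_real_derivative Re A) (at t within I)"
    and 4: "((\<lambda>t. Im (v t)) has_real_derivative Im A) (at t within I)"
    using r v by (auto simp: has_vector_derivative_complex_iff)
  have ReA: "Re A = (1 - (norm (v t))\<^sup>2) * Re (v t) - Re (r t)"
    and ImA: "Im A = (1 - (norm (v t))\<^sup>2) * Im (v t) - Im (r t)" by (auto simp: A_def)
  have speed: "(norm (v t))\<^sup>2 = Re (v t) * Re (v t) + Im (v t) * Im (v t)"
    and radius: "(norm (r t))\<^sup>2 = Re (r t) * Re (r t) + Im (r t) * Im (r t)"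
    unfolding cmod_power2 by (simp_all add: power2_eq_square)
  show "((\<lambda>t. (norm (r t))\<^sup>2) has_real_derivative 2 * (r t \<bullet> v t)) (at t within I)"
    unfolding cmod_power2 inner_complex_def
    by (rule derivative_eq_intros 1 2 refl)+ (simp add: algebra_simps)
  have "((\<lambda>t. (norm (v t))\<^sup>2) has_real_derivative 2 * Re (v t) * Re A + 2 * Im (v t) * Im A) (at t within I)"
    unfolding cmod_power2 inner_complex_def
    by (rule derivative_eq_intros 3 4 refl)+ (simp add: algebra_simps)
  moreover have "2 * Re (v t) * Re A + 2 * Im (v t) * Im A =
     2 * (1 - (norm (v t))\<^sup>2) * (norm (v t))\<^sup>2 - 2 * (r t \<bullet> v t)"
    unfolding ReA ImA speed radius inner_complex_def by (simp add: algebra_simps)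
  ultimately show "((\<lambda>t. (norm (v t))\<^sup>2) has_real_derivative
            2 * (1 - (norm (v t))\<^sup>2) * (norm (v t))\<^sup>2 - 2 * (r t \<bullet> v t)) (at t within I)" by simp
  have "((\<lambda>t. r t \<bullet> v t) has_real_derivative
      (norm (v t))\<^sup>2 + Re (r t) * Re A + Im (r t) * Im A) (at t within I)"
    unfolding cmod_power2 inner_complex_def
    by (rule derivative_eq_intros 1 2 3 4 refl)+ (simp add: power2_eq_square algebra_simps)
  moreover have "(norm (v t))\<^sup>2 + Re (r t) * Re A + Im (r t) * Im A =
     (norm (v t))\<^sup>2 + (1 - (norm (v t))\<^sup>2) * (r t \<bullet> v t) - (norm (r t))\<^sup>2"
    unfolding ReA ImA speed radius inner_complex_def by (simp add: algebra_simps)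
  ultimately show "((\<lambda>t. r t \<bullet> v t) has_real_derivative
            (norm (v t))\<^sup>2 + (1 - (norm (v t))\<^sup>2) * (r t \<bullet> v t) - (norm (r t))\<^sup>2) (at t within I)" by simp
  have "((\<lambda>t. ang_mom s (r t) (v t)) has_real_derivative
      s * (Re (r t) * Im A - Im (r t) * Re A)) (at t within I)"
    unfolding ang_mom_eq
    by (rule derivative_eq_intros 1 2 3 4 refl)+ (simp add: algebra_simps)
  moreover have "s * (Re (r t) * Im A - Im (r t) * Re A) = (1 - (norm (v t))\<^sup>2) * ang_mom s (r t) (v t)"
    unfolding ReA ImA by (simp add: ang_mom_def algebra_simps)
  ultimately show "((\<lambda>t. ang_mom s (r t) (v t)) has_real_derivative
            (1 - (norm (v t))\<^sup>2) * ang_mom s (r t) (v t)) (at t within I)" by simp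
qed

lemma trajectory_continuous_on:
  assumes "trajectory I r v"
  shows "continuous_on I r" "continuous_on I v"
  using assms unfolding trajectory_def continuous_on_eq_continuous_within
  by (meson has_vector_derivative_continuous)+

text \<open>
  The angular momentum solves the linear equation \<open>L' = (1 - b) L\<close>, so \<open>L exp (- P)\<close> is constant
  for an antiderivative \<open>P\<close> of \<open>1 - b\<close>. The instants \<open>t1\<close> and \<open>t2\<close> may come in either order.
\<close>

lemma ang_mom_sign_invariant:
  assumes tr: "trajectory {0..T} r v" and st: "t1 \<in> {0..T}" "t2 \<in> {0..T}"
    and pos: "0 < ang_mom s (r t1) (v t1)"
  shows "0 < ang_mom s (r t2) (v t2)"
proof -
  let ?L = "\<lambda>t. ang_mom s (r t) (v t)"
  have "continuous_on {0..T} (\<lambda>t. 1 - (norm (v t))\<^sup>2)"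
    by (intro continuous_intros trajectory_continuous_on[OF tr])
  then obtain P where P: "\<And>t. t \<in> {0..T} \<Longrightarrow>
      (P has_vector_derivative (1 - (norm (v t))\<^sup>2)) (at t within {0..T})"
    using antiderivative_continuous by blast
  have "((\<lambda>t. ?L t * exp (- P t)) has_real_derivative 0) (at t within {0..T})"
    if "t \<in> {0..T}" for t
    by (rule derivative_eq_intros trajectory_derivatives(4)[OF tr that]
       P[OF that, folded has_real_derivative_iff_has_vector_derivative] refl | simp add: algebra_simps)+
  then obtain k where k: "\<And>t. t \<in> {0..T} \<Longrightarrow> ?L t * exp (- P t) = k"
    using has_field_derivative_zero_constant[of "{0..T}" "\<lambda>t. ?L t * exp (- P t)"] by auto
  have "k > 0" using k[OF st(1)] pos by (metis mult_pos_pos exp_gt_zero)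
  thus ?thesis using k[OF st(2)] by (metis zero_less_mult_pos2 exp_gt_zero)
qed

lemma gap_lower_bounds:
  assumes "s * s = 1" "0 < ang_mom s z w"
  shows "(norm (w - s *\<^sub>R (\<i> * z)))\<^sup>2 \<le> gap s z w"
    "2 * (sqrt (ang_mom s z w) - 1)\<^sup>2 \<le> gap s z w" "0 \<le> gap s z w"
proof -
  have "(sqrt (ang_mom s z w) - 1)\<^sup>2 \<le> ang_mom s z w - 1 - ln (ang_mom s z w)"
    using ln_defect_bounds assms(2) by blast
  moreover have "0 \<le> (sqrt (ang_mom s z w) - 1)\<^sup>2" "0 \<le> (norm (w - s *\<^sub>R (\<i> * z)))\<^sup>2" by auto
  ultimately show "(norm (w - s *\<^sub>R (\<i> * z)))\<^sup>2 \<le> gap s z w"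
    "2 * (sqrt (ang_mom s z w) - 1)\<^sup>2 \<le> gap s z w" "0 \<le> gap s z w"
    unfolding gap_eq[OF assms(1)] by argo+
qed

lemma gap_derivative:
  assumes "trajectory I r v" "t \<in> I" "0 < ang_mom s (r t) (v t)"
  shows "((\<lambda>t. gap s (r t) (v t)) has_real_derivative - 2 * ((norm (v t))\<^sup>2 - 1)\<^sup>2) (at t within I)"
proof -
  let ?b = "(norm (v t))\<^sup>2" and ?c = "r t \<bullet> v t" and ?L = "ang_mom s (r t) (v t)"
  have "((\<lambda>t. ln (ang_mom s (r t) (v t))) has_real_derivative (1 - ?b) * ?L / ?L) (at t within I)"
    using DERIV_chain2[OF DERIV_ln_divide[OF assms(3)] trajectory_derivatives(4)[OF assms(1,2)]]
    by simp
  hence ln: "((\<lambda>t. ln (ang_mom s (r t) (v t))) has_real_derivative 1 - ?b) (at t within I)"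
    using assms(3) by simp
  have "((\<lambda>t. gap s (r t) (v t)) has_real_derivative
      2 * ?c + (2 * (1 - ?b) * ?b - 2 * ?c) - 0 - 2 * (1 - ?b)) (at t within I)"
    unfolding gap_def
    by (intro DERIV_diff DERIV_add DERIV_cmult DERIV_const ln trajectory_derivatives[OF assms(1,2)])
  thus ?thesis by (simp add: power2_eq_square algebra_simps)
qed

lemma gap_nonincreasing:
  assumes tr: "trajectory {0..T} r v" and T: "0 \<le> T" and pos: "0 < ang_mom s (r 0) (v 0)"
  shows "gap s (r T) (v T) \<le> gap s (r 0) (v 0)"
proof -
  have "gap s (r T) (v T) \<le> gap s (r 0) (v 0) * exp (- 0 * T)"
    by (rule exponential_decay[OF T gap_derivative[OF tr]])
      (use ang_mom_sign_invariant[OF tr _ _ pos] T in auto)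
  thus ?thesis by simp
qed

section \<open>Exponential decay of the gap\<close>

text \<open>
  Sublevel sets of the gap in the region of positive angular momentum are bounded and stay away
  from its boundary, since \<open>ln L \<le> L / 2 \<le> (a + b) / 4\<close>.
\<close>

lemma gap_bounds:
  assumes s: "s * s = 1" and L: "0 < ang_mom s z w" and G: "gap s z w \<le> G"
  defines "K \<equiv> 2 * G + 5"
  shows "(norm z)\<^sup>2 \<le> K" "(norm w)\<^sup>2 \<le> K" "\<bar>z \<bullet> w\<bar> \<le> K" "ang_mom s z w \<le> K"
    "exp (- K / 2) \<le> ang_mom s z w"
proof -
  let ?a = "(norm z)\<^sup>2" and ?b = "(norm w)\<^sup>2" and ?L = "ang_mom s z w"
  have ab: "0 \<le> ?a" "0 \<le> ?b" by auto
  have "0 \<le> (norm (w - s *\<^sub>R (\<i> * z)))\<^sup>2" by simp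
  hence LS: "2 * ?L \<le> ?a + ?b" unfolding norm_defect[OF s] by simp
  have G': "?a + ?b - 2 - 2 * ln ?L \<le> G" using G by (simp add: gap_def)
  have "ln ?L = ln (?L / 2) + ln 2" using L by (simp add: ln_div)
  also have "\<dots> \<le> ?L / 2" using ln_le_minus_one[of "?L / 2"] ln_2_less_1 L by simp
  finally have ln: "ln ?L \<le> ?L / 2" .
  have S: "?a + ?b \<le> 2 * G + 4" using ln LS G' by linarith
  show "?a \<le> K" "?b \<le> K" "?L \<le> K" unfolding K_def using S ab LS G by linarith+
  have "2 * \<bar>z \<bullet> w\<bar> \<le> 2 * (norm z * norm w)" using Cauchy_Schwarz_ineq2[of z w] by simp
  also have "\<dots> \<le> ?a + ?b" using sum_squares_bound[of "norm z" "norm w"] by simp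
  finally show "\<bar>z \<bullet> w\<bar> \<le> K" using S ab by (simp add: K_def)
  have "- K / 2 \<le> ln ?L" using G' ab S unfolding K_def by argo
  thus "exp (- K / 2) \<le> ?L" using L by (metis exp_ln exp_le_cancel_iff)
qed

text \<open>
  The left-hand side is the derivative of \<open>W\<close> along a trajectory. The cross term
  \<open>(b - 1) c\<close> contributes \<open>-2 c^2\<close>; the term \<open>c (a - b) / 4\<close> contributes \<open>- (a - b)^2 / 4\<close> at the price
  of \<open>c^2\<close>. The remaining products are absorbed by completing squares.
\<close>

lemma dissipation_estimate:
  fixes a b c K \<epsilon> :: real
  assumes K: "1 \<le> K" and a: "0 \<le> a" "a \<le> K" and b: "0 \<le> b" "b \<le> K"
    and \<epsilon>: "0 \<le> \<epsilon>" "\<epsilon> * (2 + 8 * K\<^sup>2) \<le> 1"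
  shows "- 2 * (b - 1)\<^sup>2 + \<epsilon> * (- c\<^sup>2 - (a - b)\<^sup>2 / 4 - (b - 1) * (a - b)
            - (b - 1) * c * (5 / 2 * b - 1 + (a - b) / 4))
         \<le> - (\<epsilon> / 8) * ((b - 1)\<^sup>2 + c\<^sup>2 + (a - b)\<^sup>2)"
proof -
  define \<beta> x H where "\<beta> = b - 1" and "x = a - b" and "H = 5 / 2 * b - 1 + (a - b) / 4"
  have "\<bar>H\<bar> \<le> 4 * K" unfolding H_def using K a b by (simp add: abs_le_iff field_simps)
  hence "H\<^sup>2 \<le> (4 * K)\<^sup>2" using K power_mono[of "\<bar>H\<bar>" "4 * K" 2] by simp
  hence H: "H\<^sup>2 * \<beta>\<^sup>2 \<le> 16 * K\<^sup>2 * \<beta>\<^sup>2" by (simp add: mult_right_mono power_mult_distrib)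
  have "0 \<le> (x + 4 * \<beta>)\<^sup>2" "0 \<le> (c + H * \<beta>)\<^sup>2" by auto
  hence "- (\<beta> * x) \<le> x\<^sup>2 / 8 + 2 * \<beta>\<^sup>2" "- (\<beta> * c * H) \<le> c\<^sup>2 / 2 + H\<^sup>2 * \<beta>\<^sup>2 / 2"
    by (simp_all add: power2_eq_square algebra_simps)
  hence "- c\<^sup>2 - x\<^sup>2 / 4 - \<beta> * x - \<beta> * c * H \<le> - (c\<^sup>2 / 2) - x\<^sup>2 / 8 + (2 * \<beta>\<^sup>2 + 8 * K\<^sup>2 * \<beta>\<^sup>2)"
    using H by argo
  from mult_left_mono[OF this \<epsilon>(1)]
  have 1: "\<epsilon> * (- c\<^sup>2 - x\<^sup>2 / 4 - \<beta> * x - \<beta> * c * H)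
      \<le> - (\<epsilon> * c\<^sup>2) / 2 - \<epsilon> * x\<^sup>2 / 8 + \<epsilon> * (2 + 8 * K\<^sup>2) * \<beta>\<^sup>2"
    by (simp add: algebra_simps)
  have 2: "\<epsilon> * (2 + 8 * K\<^sup>2) * \<beta>\<^sup>2 \<le> 1 * \<beta>\<^sup>2" by (rule mult_right_mono[OF \<epsilon>(2)]) simp
  have "\<epsilon> * 2 \<le> \<epsilon> * (2 + 8 * K\<^sup>2)" using \<epsilon>(1) by (intro mult_left_mono) auto
  hence "\<epsilon> / 8 \<le> 1" using \<epsilon> by argo
  hence 3: "\<epsilon> / 8 * \<beta>\<^sup>2 \<le> 1 * \<beta>\<^sup>2" by (rule mult_right_mono) simp
  have 4: "0 \<le> \<epsilon> * c\<^sup>2" using \<epsilon>(1) by simp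
  have "- 2 * \<beta>\<^sup>2 + \<epsilon> * (- c\<^sup>2 - x\<^sup>2 / 4 - \<beta> * x - \<beta> * c * H)
      \<le> - (\<epsilon> / 8 * \<beta>\<^sup>2) - (\<epsilon> * c\<^sup>2) / 8 - (\<epsilon> * x\<^sup>2) / 8" using 1 2 3 4 by argo
  also have "\<dots> = - (\<epsilon> / 8) * (\<beta>\<^sup>2 + c\<^sup>2 + x\<^sup>2)" by (simp add: algebra_simps)
  finally show ?thesis unfolding \<beta>_def x_def H_def .
qed

lemma cross_term_bound:
  fixes \<beta> c x :: real
  shows "\<bar>\<beta> * c + c * x / 4\<bar> \<le> \<beta>\<^sup>2 + c\<^sup>2 + x\<^sup>2"
proof -
  have "0 \<le> (\<beta> + c)\<^sup>2" "0 \<le> (\<beta> - c)\<^sup>2" "0 \<le> (c + x)\<^sup>2" "0 \<le> (c - x)\<^sup>2" by auto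
  moreover have "(\<beta> + c)\<^sup>2 = \<beta>\<^sup>2 + 2 * (\<beta> * c) + c\<^sup>2" "(\<beta> - c)\<^sup>2 = \<beta>\<^sup>2 - 2 * (\<beta> * c) + c\<^sup>2"
    "(c + x)\<^sup>2 = c\<^sup>2 + 2 * (c * x) + x\<^sup>2" "(c - x)\<^sup>2 = c\<^sup>2 - 2 * (c * x) + x\<^sup>2"
    by (simp_all add: power2_eq_square algebra_simps)
  moreover have "0 \<le> \<beta>\<^sup>2" "0 \<le> c\<^sup>2" "0 \<le> x\<^sup>2" by auto
  ultimately have "\<beta> * c + c * x / 4 \<le> \<beta>\<^sup>2 + c\<^sup>2 + x\<^sup>2" "- (\<beta> * c + c * x / 4) \<le> \<beta>\<^sup>2 + c\<^sup>2 + x\<^sup>2"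
    by argo+
  thus ?thesis by linarith
qed

text \<open>
  The rate and the constant depend only on the bound \<open>G\<close> for the initial gap.
\<close>

lemma gap_exponential_decay:
  assumes s: "s * s = 1" and G: "0 \<le> G"
  obtains k C where "0 < k"
    "\<And>T r v. \<lbrakk>trajectory {0..T} r v; 0 \<le> T; 0 < ang_mom s (r 0) (v 0); gap s (r 0) (v 0) \<le> G\<rbrakk>
       \<Longrightarrow> gap s (r T) (v T) \<le> C * exp (- k * T)"
proof -
  \<comment> \<open>The bound from \<open>gap_bounds\<close> for the sublevel set of level \<open>G\<close>.\<close>
  define K where "K = 2 * G + 5"
  have K: "1 \<le> K" using G by (simp add: K_def)
  obtain m M where mM: "0 < m" "0 < M" and
    equiv: "\<And>a b c L :: real. \<lbrakk>0 \<le> a; a \<le> K; 0 \<le> b; b \<le> K; \<bar>c\<bar> \<le> K; exp (- K / 2) \<le> L;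
        L \<le> K; a * b = c\<^sup>2 + L\<^sup>2\<rbrakk>
       \<Longrightarrow> m * ((b - 1)\<^sup>2 + c\<^sup>2 + (a - b)\<^sup>2) \<le> a + b - 2 - 2 * ln L \<and>
          a + b - 2 - 2 * ln L \<le> M * ((b - 1)\<^sup>2 + c\<^sup>2 + (a - b)\<^sup>2)"
    using gap_equivalent_quadratic[OF K, of "exp (- K / 2)"] by (metis exp_gt_zero)
  \<comment> \<open>The first bound is needed for the dissipation estimate; the second keeps \<open>W\<close> between
      \<open>gap / 2\<close> and \<open>2 * gap\<close>.\<close>
  define \<epsilon> where "\<epsilon> = min (1 / (2 + 8 * K\<^sup>2)) (m / 2)"
  have K8: "2 + 8 * K\<^sup>2 > 0" by (simp add: add_pos_nonneg)
  have \<epsilon>: "0 < \<epsilon>" "\<epsilon> \<le> m / 2" using mM K8 by (auto simp: \<epsilon>_def)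
  have "\<epsilon> \<le> 1 / (2 + 8 * K\<^sup>2)" by (simp add: \<epsilon>_def)
  hence \<epsilon>2: "\<epsilon> * (2 + 8 * K\<^sup>2) \<le> 1" using K8 by (simp add: field_simps)
  define k where "k = \<epsilon> / 8 / (M + \<epsilon>)"
  have k: "0 < k" using \<epsilon> mM by (simp add: k_def add_pos_pos)
  have "gap s (r T) (v T) \<le> 4 * G * exp (- k * T)"
    if tr: "trajectory {0..T} r v" and T: "0 \<le> T" and pos: "0 < ang_mom s (r 0) (v 0)"
      and start: "gap s (r 0) (v 0) \<le> G" for T r v
  proof -
    define a b c where "a t = (norm (r t))\<^sup>2" and "b t = (norm (v t))\<^sup>2" and "c t = r t \<bullet> v t" for t
    define Y where "Y t = gap s (r t) (v t)" for t
    define X where "X t = (b t - 1) * c t + c t * (a t - b t) / 4" for t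
    define Q where "Q t = (b t - 1)\<^sup>2 + (c t)\<^sup>2 + (a t - b t)\<^sup>2" for t
    define W where "W t = Y t + \<epsilon> * X t" for t
    define W' where "W' t = - 2 * (b t - 1)\<^sup>2 + \<epsilon> * (- (c t)\<^sup>2 - (a t - b t)\<^sup>2 / 4
        - (b t - 1) * (a t - b t) - (b t - 1) * c t * (5 / 2 * b t - 1 + (a t - b t) / 4))" for t
    have L: "0 < ang_mom s (r t) (v t)" if "t \<in> {0..T}" for t
      using ang_mom_sign_invariant[OF tr _ that pos] T by simp
    have gapG: "gap s (r t) (v t) \<le> G" if "t \<in> {0..T}" for t
      using gap_nonincreasing[OF trajectory_subset[OF tr, of "{0..t}"] _ pos] that start by force
    note bounds = gap_bounds[OF s L gapG, folded K_def]
    have YQ: "m * Q t \<le> Y t" "Y t \<le> M * Q t" if "t \<in> {0..T}" for t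
      using equiv[OF _ bounds(1)[OF that that] _ bounds(2)[OF that that] bounds(3)[OF that that]
          bounds(5)[OF that that] bounds(4)[OF that that] lagrange_identity[OF s]]
      by (auto simp: Q_def Y_def gap_def a_def b_def c_def)
    have Q0: "0 \<le> Q t" for t by (simp add: Q_def)
    have X: "\<bar>X t\<bar> \<le> Q t" for t unfolding X_def Q_def by (rule cross_term_bound)
    have \<epsilon>X: "\<bar>\<epsilon> * X t\<bar> \<le> \<epsilon> * Q t" for t using X[of t] \<epsilon> by (simp add: abs_mult)
    have \<epsilon>Q: "\<epsilon> * Q t \<le> Y t / 2" if "t \<in> {0..T}" for t
      using mult_right_mono[OF \<epsilon>(2) Q0[of t]] YQ(1)[OF that] by simp
    have WY: "Y t \<le> 2 * W t" "W t \<le> 2 * Y t" "W t \<le> (M + \<epsilon>) * Q t" if "t \<in> {0..T}" for t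
    proof -
      have "0 \<le> Y t" using gap_lower_bounds[OF s L[OF that]] by (simp add: Y_def)
      thus "Y t \<le> 2 * W t" "W t \<le> 2 * Y t"
        using \<epsilon>X[of t] \<epsilon>Q[OF that] unfolding W_def abs_le_iff by argo+
      show "W t \<le> (M + \<epsilon>) * Q t" using \<epsilon>X[of t] YQ(2)[OF that]
        unfolding W_def abs_le_iff distrib_right by argo
    qed
    have "W T \<le> W 0 * exp (- k * T)"
    proof (rule exponential_decay[OF T])
      fix t assume t: "t \<in> {0..T}"
      let ?b' = "2 * (1 - b t) * b t - 2 * c t" and ?c' = "b t + (1 - b t) * c t - a t"
      note d = trajectory_derivatives(1-3)[OF tr t, folded a_def b_def c_def]
      have dY: "(Y has_real_derivative - 2 * (b t - 1)\<^sup>2) (at t within {0..T})"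
        using gap_derivative[OF tr t L[OF t]] unfolding Y_def b_def .
      have "(X has_real_derivative (?b' - 0) * c t + ?c' * (b t - 1)
          + (?c' * (a t - b t) + (2 * c t - ?b') * c t) / 4) (at t within {0..T})"
        unfolding X_def by (intro DERIV_add DERIV_cdivide DERIV_mult DERIV_diff DERIV_const d)
      hence "(W has_real_derivative - 2 * (b t - 1)\<^sup>2 + \<epsilon> * ((?b' - 0) * c t + ?c' * (b t - 1)
          + (?c' * (a t - b t) + (2 * c t - ?b') * c t) / 4)) (at t within {0..T})"
        unfolding W_def by (intro DERIV_add DERIV_cmult dY)
      also have "(?b' - 0) * c t + ?c' * (b t - 1) + (?c' * (a t - b t) + (2 * c t - ?b') * c t) / 4
          = - (c t)\<^sup>2 - (a t - b t)\<^sup>2 / 4 - (b t - 1) * (a t - b t)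
            - (b t - 1) * c t * (5 / 2 * b t - 1 + (a t - b t) / 4)"
        by (simp add: power2_eq_square field_simps)
      finally show "(W has_real_derivative W' t) (at t within {0..T})" unfolding W'_def .
      have W': "W' t \<le> - (\<epsilon> / 8) * Q t"
        unfolding W'_def Q_def a_def b_def
        by (rule dissipation_estimate[OF K _ bounds(1)[OF t t] _ bounds(2)[OF t t] _ \<epsilon>2])
          (use \<epsilon> in auto)
      have "\<epsilon> / 8 = k * (M + \<epsilon>)"
        unfolding k_def
        by (rule nonzero_divide_eq_eq[THEN iffD1, OF _ refl]) (use \<epsilon> mM in linarith)
      hence "k * W t \<le> \<epsilon> / 8 * Q t"
        using mult_left_mono[OF WY(3)[OF t], of k] k by (simp only: mult.assoc)
      hence "- (\<epsilon> / 8) * Q t \<le> - k * W t" by simp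
      with W' show "W' t \<le> - k * W t" by linarith
    qed
    moreover have "W 0 * exp (- k * T) \<le> 2 * G * exp (- k * T)"
      using WY(2)[of 0] start T by (intro mult_right_mono) (auto simp: Y_def)
    moreover have "gap s (r T) (v T) \<le> 2 * W T" using WY(1)[of T] T by (simp add: Y_def)
    ultimately show ?thesis by linarith
  qed
  with k show thesis by (rule that)
qed

section \<open>The limit cycles in phase space\<close>

text \<open>
  Uniform rotation on the unit circle with angular velocity \<open>s\<close>; both families of limit cycles
  have this form.
\<close>

definition rotation :: "real \<Rightarrow> real \<Rightarrow> real \<Rightarrow> complex" where
  "rotation s \<theta> t = cis \<theta> * cis (s * t)"

text \<open>
  The common orbit in phase space of all the rotations with angular velocity \<open>s\<close>.
\<close>

definition phase_circle :: "real \<Rightarrow> (complex \<times> complex) set" where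
  "phase_circle s = {(z, s *\<^sub>R (\<i> * z)) | z. norm z = 1}"

lemma cis_has_vector_derivative:
  "((\<lambda>t. cis (s * t)) has_vector_derivative s *\<^sub>R (\<i> * cis (s * t))) (at t within I)"
proof -
  have "((\<lambda>t. cos (s * t)) has_real_derivative - s * sin (s * t)) (at t within I)"
    "((\<lambda>t. sin (s * t)) has_real_derivative s * cos (s * t)) (at t within I)"
    by (rule derivative_eq_intros refl | simp)+
  thus ?thesis by (simp add: has_vector_derivative_complex_iff)
qed

lemma rotation_trajectory:
  assumes s: "s * s = 1"
  shows "trajectory UNIV (rotation s \<theta>) (\<lambda>t. s *\<^sub>R (\<i> * rotation s \<theta> t))"
proof -
  have d: "(rotation s \<theta> has_vector_derivative s *\<^sub>R (\<i> * rotation s \<theta> t)) (at t)" for t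
    unfolding rotation_def
    using has_vector_derivative_mult_right[OF cis_has_vector_derivative[of s t UNIV], of "cis \<theta>"]
    by (simp add: mult.left_commute)
  have "((\<lambda>t. s *\<^sub>R (\<i> * rotation s \<theta> t)) has_vector_derivative
      s *\<^sub>R (\<i> * (s *\<^sub>R (\<i> * rotation s \<theta> t)))) (at t)" for t
    by (intro derivative_intros d has_vector_derivative_mult_right
       bounded_linear.has_vector_derivative[OF bounded_linear_scaleR_right])
  moreover have "s *\<^sub>R (\<i> * (s *\<^sub>R (\<i> * z))) = - z" for z :: complex
  proof -
    have "s *\<^sub>R (\<i> * (s *\<^sub>R (\<i> * z))) = (s * s) *\<^sub>R (\<i> * (\<i> * z))" by simp
    also have "\<dots> = - z" using s by (simp flip: mult.assoc)
    finally show ?thesis .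
  qed
  moreover have "\<bar>s\<bar> = 1" using s by (auto simp: square_eq_1_iff)
  ultimately show ?thesis unfolding trajectory_def using d
    by (simp add: norm_mult rotation_def)
qed

lemma trajectory_velocity:
  assumes "trajectory UNIV r v"
  shows "velocity UNIV r = v"
  using assms by (auto simp: trajectory_def velocity_def fun_eq_iff intro: vector_derivative_at)

lemma rotation_periodic:
  assumes s: "s * s = 1"
  shows "rotation s \<theta> (t + 2 * pi) = rotation s \<theta> t"
proof -
  have "s = 1 \<or> s = -1" using s by (simp add: square_eq_1_iff)
  thus ?thesis by (auto simp: rotation_def complex_eq_iff sin_add cos_add sin_diff cos_diff)
qed

lemma rotation_periodic_solution:
  assumes s: "s * s = 1"
  shows "periodic_solution (rotation s \<theta>)"
proof -
  have "s = 1 \<or> s = -1" using s by (simp add: square_eq_1_iff)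
  hence "rotation s \<theta> pi = - rotation s \<theta> 0" by (auto simp: rotation_def complex_eq_iff)
  moreover have "rotation s \<theta> 0 \<noteq> 0" by (simp add: rotation_def)
  ultimately have "rotation s \<theta> pi \<noteq> rotation s \<theta> 0" by simp
  hence "\<not> rotation s \<theta> constant_on UNIV" unfolding constant_on_def by (metis UNIV_I)
  moreover have "solution UNIV (rotation s \<theta>)"
    unfolding solution_iff_trajectory using rotation_trajectory[OF s]
    by (simp add: trajectory_velocity[OF rotation_trajectory[OF s]])
  moreover have "\<exists>T>0. \<forall>t. rotation s \<theta> (t + T) = rotation s \<theta> t"
    using rotation_periodic[OF s] by (intro exI[of _ "2 * pi"]) auto
  ultimately show ?thesis by (simp add: periodic_solution_def)
qed

lemma rotation_orbit:
  assumes s: "s * s = 1"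
  shows "orbit (rotation s \<theta>) = phase_circle s"
proof -
  have st: "state UNIV (rotation s \<theta>) t = (rotation s \<theta> t, s *\<^sub>R (\<i> * rotation s \<theta> t))" for t
    by (simp add: state_def trajectory_velocity[OF rotation_trajectory[OF s]])
  have "\<exists>t. z = rotation s \<theta> t" if "norm z = 1" for z
  proof -
    have "z = cis (Arg z)" using cis_Arg[of z] that by (cases "z = 0") (auto simp: sgn_eq)
    also have "\<dots> = rotation s \<theta> (s * (Arg z - \<theta>))"
      using s by (simp add: rotation_def cis_mult flip: mult.assoc)
    finally show ?thesis by blast
  qed
  moreover have "norm (rotation s \<theta> t) = 1" for t by (simp add: rotation_def norm_mult)
  ultimately show ?thesis unfolding orbit_def phase_circle_def image_def st by auto
qed

text \<open>
  With \<open>d = w - s i z\<close> one has \<open>L - |z|^2 = s Im (cnj z d)\<close>, hence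
  \<open>|sqrt L - |z|| \<le> |d|\<close>; both \<open>|d|\<close> and \<open>|sqrt L - 1|\<close> are at most \<open>sqrt gap\<close>.
\<close>

lemma norm_near_one:
  assumes s: "s * s = 1" and L: "0 < ang_mom s z w"
  shows "\<bar>norm z - 1\<bar> \<le> 2 * sqrt (gap s z w)"
proof -
  define d where "d = w - s *\<^sub>R (\<i> * z)"
  let ?L = "ang_mom s z w" and ?e = "sqrt (gap s z w)"
  have d: "norm d \<le> ?e" unfolding d_def using gap_lower_bounds(1)[OF s L] by (rule real_le_rsqrt)
  have "(sqrt ?L - 1)\<^sup>2 \<le> gap s z w"
    using gap_lower_bounds(2,3)[OF s L] zero_le_power2[of "sqrt ?L - 1"] by linarith
  hence L1: "\<bar>sqrt ?L - 1\<bar> \<le> ?e" by (intro real_le_rsqrt) simp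
  have z: "0 < norm z" using L by (auto simp: ang_mom_def)
  have "?L = s * s * (norm z)\<^sup>2 + s * Im (cnj z * d)"
    unfolding d_def ang_mom_def cmod_power2 by (simp add: power2_eq_square algebra_simps)
  hence "?L - (norm z)\<^sup>2 = s * Im (cnj z * d)" using s by simp
  moreover have "\<bar>s\<bar> = 1" using s by (auto simp: square_eq_1_iff)
  ultimately have "\<bar>?L - (norm z)\<^sup>2\<bar> \<le> norm z * norm d"
    using abs_Im_le_cmod[of "cnj z * d"] by (simp add: abs_mult norm_mult)
  moreover have "?L - (norm z)\<^sup>2 = (sqrt ?L - norm z) * (sqrt ?L + norm z)"
    using L by (simp add: power2_eq_square algebra_simps)
  ultimately have "\<bar>sqrt ?L - norm z\<bar> * (sqrt ?L + norm z) \<le> norm z * norm d"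
    using z L by (simp add: abs_mult)
  moreover have "\<bar>sqrt ?L - norm z\<bar> * norm z \<le> \<bar>sqrt ?L - norm z\<bar> * (sqrt ?L + norm z)"
    using L by (intro mult_left_mono) auto
  ultimately have "norm z * \<bar>sqrt ?L - norm z\<bar> \<le> norm z * norm d" by (simp add: mult.commute)
  hence "\<bar>sqrt ?L - norm z\<bar> \<le> norm d" using z by simp
  thus ?thesis using L1 d by linarith
qed

lemma infdist_phase_circle_le:
  assumes s: "s * s = 1" and L: "0 < ang_mom s z w"
  shows "infdist (z, w) (phase_circle s) \<le> 5 * sqrt (gap s z w)"
proof -
  let ?e = "sqrt (gap s z w)"
  \<comment> \<open>The point of the circle closest in position.\<close>
  define y where "y = sgn z"
  have z: "z \<noteq> 0" using L by (auto simp: ang_mom_def)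
  have s1: "\<bar>s\<bar> = 1" using s by (auto simp: square_eq_1_iff)
  have "norm y = 1" using z by (simp add: y_def norm_sgn)
  hence "(y, s *\<^sub>R (\<i> * y)) \<in> phase_circle s" by (auto simp: phase_circle_def)
  hence 1: "infdist (z, w) (phase_circle s) \<le> dist (z, w) (y, s *\<^sub>R (\<i> * y))" by (rule infdist_le)
  have "z - y = (norm z - 1) *\<^sub>R y" using z
    by (simp add: y_def sgn_div_norm scaleR_conv_of_real field_simps)
  hence zy: "norm (z - y) \<le> 2 * ?e"
    using norm_near_one[OF s L] \<open>norm y = 1\<close> by (metis norm_scaleR real_norm_def mult.right_neutral)
  have "norm (w - s *\<^sub>R (\<i> * z)) \<le> ?e" using gap_lower_bounds(1)[OF s L] by (rule real_le_rsqrt)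
  moreover have "norm (s *\<^sub>R (\<i> * z) - s *\<^sub>R (\<i> * y)) = norm (z - y)"
  proof -
    have "s *\<^sub>R (\<i> * z) - s *\<^sub>R (\<i> * y) = s *\<^sub>R (\<i> * (z - y))" by (simp add: algebra_simps)
    thus ?thesis using s1 by (simp add: norm_mult)
  qed
  ultimately have wy: "norm (w - s *\<^sub>R (\<i> * y)) \<le> 3 * ?e"
    using norm_triangle_ineq[of "w - s *\<^sub>R (\<i> * z)" "s *\<^sub>R (\<i> * z) - s *\<^sub>R (\<i> * y)"] zy by simp
  have "dist (z, w) (y, s *\<^sub>R (\<i> * y)) \<le> norm (z - y) + norm (w - s *\<^sub>R (\<i> * y))"
    unfolding dist_Pair_Pair unfolding dist_norm by (rule sqrt_sum_squares_le_sum) auto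
  thus ?thesis using 1 zy wy by linarith
qed

lemma near_phase_circle:
  assumes s: "s * s = 1" and near: "infdist (z, w) (phase_circle s) < d" and d: "d \<le> 1 / 6"
  shows "0 < ang_mom s z w" "gap s z w \<le> 40 * d\<^sup>2"
proof -
  have s1: "\<bar>s\<bar> = 1" using s by (auto simp: square_eq_1_iff)
  have "(1, s *\<^sub>R (\<i> * 1)) \<in> phase_circle s" by (auto simp: phase_circle_def)
  hence "phase_circle s \<noteq> {}" by blast
  then obtain y where y: "norm y = 1" and "dist (z, w) (y, s *\<^sub>R (\<i> * y)) < d"
    using near unfolding infdist_notempty[OF \<open>phase_circle s \<noteq> {}\<close>]
    by (auto simp: cINF_less_iff phase_circle_def)
  hence "norm (z - y) < d" "norm (w - s *\<^sub>R (\<i> * y)) < d"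
    using dist_fst_le[of "(z, w)" "(y, s *\<^sub>R (\<i> * y))"] dist_snd_le[of "(z, w)" "(y, s *\<^sub>R (\<i> * y))"]
    by (auto simp: dist_norm)
  define p q where "p = z - y" and "q = w - s *\<^sub>R (\<i> * y)"
  have pq: "norm p < d" "norm q < d" unfolding p_def q_def by fact+
  have zw: "z = y + p" "w = s *\<^sub>R (\<i> * y) + q" by (auto simp: p_def q_def)
  have d0: "0 < d" using pq(1) norm_ge_zero[of p] by linarith
  let ?L = "ang_mom s z w"
  have "?L - 1 = s * Im (cnj p * w) + s * Im (cnj y * q)"
  proof -
    have "?L = s * s * (norm y)\<^sup>2 + s * Im (cnj p * w) + s * Im (cnj y * q)"
      unfolding ang_mom_def cmod_power2 by (simp add: zw power2_eq_square algebra_simps)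
    thus ?thesis using s y by simp
  qed
  hence "\<bar>?L - 1\<bar> \<le> \<bar>s * Im (cnj p * w)\<bar> + \<bar>s * Im (cnj y * q)\<bar>" by linarith
  also have "\<dots> \<le> norm p * norm w + norm q"
    using abs_Im_le_cmod[of "cnj p * w"] abs_Im_le_cmod[of "cnj y * q"] s1 y
    by (simp add: abs_mult norm_mult)
  also have "norm w \<le> 1 + norm q" unfolding zw using norm_triangle_ineq[of "s *\<^sub>R (\<i> * y)" q] s1 y
    by (simp add: norm_mult)
  hence "norm p * norm w \<le> d * 2" using pq d d0 by (intro mult_mono) auto
  finally have L1: "\<bar>?L - 1\<bar> \<le> 3 * d" using pq by simp
  hence L2: "1 / 2 \<le> ?L" using d unfolding abs_le_iff by linarith
  thus pos: "0 < ?L" by linarith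
  have "w - s *\<^sub>R (\<i> * z) = q - s *\<^sub>R (\<i> * p)" by (simp add: zw algebra_simps)
  hence "norm (w - s *\<^sub>R (\<i> * z)) \<le> norm q + norm p"
    using norm_triangle_ineq4[of q "s *\<^sub>R (\<i> * p)"] s1 by (simp add: norm_mult)
  hence "norm (w - s *\<^sub>R (\<i> * z)) \<le> 2 * d" using pq by simp
  hence 1: "(norm (w - s *\<^sub>R (\<i> * z)))\<^sup>2 \<le> (2 * d)\<^sup>2" by (intro power_mono) auto
  have "\<bar>?L - 1\<bar>\<^sup>2 \<le> (3 * d)\<^sup>2" using L1 by (intro power_mono) auto
  hence "(?L - 1)\<^sup>2 / ?L \<le> (3 * d)\<^sup>2 / (1 / 2)" using L2 by (intro frac_le) auto
  hence "?L - 1 - ln ?L \<le> (3 * d)\<^sup>2 / (1 / 2)" using ln_defect_bounds(2)[OF pos] by linarith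
  thus "gap s z w \<le> 40 * d\<^sup>2" unfolding gap_eq[OF s] using 1 by (simp add: power_mult_distrib)
qed

section \<open>Convergence with asymptotic phase\<close>

lemma exp_decay_tendsto:
  fixes k C :: real
  assumes "0 < k"
  shows "((\<lambda>t. C * exp (- k * t)) \<longlongrightarrow> 0) at_top"
proof -
  have "filterlim (\<lambda>t. - k * t) at_bot at_top"
    by (rule filterlim_tendsto_neg_mult_at_bot[OF tendsto_const _ filterlim_ident])
      (use assms in simp)
  from tendsto_mult_right_zero[OF filterlim_compose[OF exp_at_bot this]] show ?thesis .
qed

lemma exponentially_bounded_derivative_converges:
  fixes u u' :: "real \<Rightarrow> complex"
  assumes k: "0 < k"
    and u: "\<And>t. 0 \<le> t \<Longrightarrow> (u has_vector_derivative u' t) (at t within {0..})"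
    and bound: "\<And>t. 0 \<le> t \<Longrightarrow> norm (u' t) \<le> C * exp (- k * t)"
  obtains l where "(u \<longlongrightarrow> l) at_top"
proof -
  have "0 \<le> C" using order_trans[OF norm_ge_zero bound[of 0]] by simp
  define D where "D = C / k"
  have D: "0 \<le> D" using \<open>0 \<le> C\<close> k by (simp add: D_def)
  have incr: "norm (u y - u x) \<le> D * exp (- k * x)" if "0 \<le> x" "x < y" for x y
  proof -
    have "continuous_on {0..} u"
      unfolding continuous_on_eq_continuous_within using u
      by (meson atLeast_iff has_vector_derivative_continuous)
    hence cont: "continuous_on {x..y} u" by (rule continuous_on_subset) (use that in auto)
    have der: "(u has_vector_derivative u' t) (at t)" if "x < t" "t < y" for t
      using u[of t] that \<open>0 \<le> x\<close> at_within_interior[of t "{0..}"] by simp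
    have "((\<lambda>t. - D * exp (- k * t)) has_vector_derivative C * exp (- k * t)) (at t)" for t
      unfolding has_real_derivative_iff_has_vector_derivative[symmetric]
      by (rule derivative_eq_intros refl)+ (use k in \<open>simp add: D_def\<close>)
    hence "norm (u y - u x) \<le> - D * exp (- k * y) - - D * exp (- k * x)"
      using that(1) by (intro differentiable_bound_general[OF that(2) cont _ der _ bound]
        continuous_intros) auto
    also have "0 \<le> D * exp (- k * y)" using D by simp
    hence "- D * exp (- k * y) - - D * exp (- k * x) \<le> D * exp (- k * x)" by simp
    finally show ?thesis .
  qed
  note lim = exp_decay_tendsto[OF k, of D]
  have "Cauchy (\<lambda>n. u (real n))"
  proof (rule metric_CauchyI)
    fix e :: real assume "0 < e"
    have "((\<lambda>n. D * exp (- k * real n)) \<longlongrightarrow> 0) sequentially"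
      by (rule filterlim_compose[OF lim filterlim_real_sequentially])
    then obtain N where N: "\<And>n. N \<le> n \<Longrightarrow> D * exp (- k * real n) < e"
      using order_tendstoD(2)[of _ 0 sequentially e] \<open>0 < e\<close>
      unfolding eventually_sequentially by blast
    have *: "norm (u (real n) - u (real m)) < e" if "N \<le> m" "m < n" for m n
      using incr[of "real m" "real n"] that N[of m] by simp
    show "\<exists>M. \<forall>m\<ge>M. \<forall>n\<ge>M. dist (u (real m)) (u (real n)) < e"
    proof (intro exI[of _ N] allI impI)
      fix m n assume "N \<le> m" "N \<le> n"
      thus "dist (u (real m)) (u (real n)) < e"
        using *[of m n] *[of n m] \<open>0 < e\<close>
        by (cases m n rule: linorder_cases) (auto simp: dist_norm norm_minus_commute)
    qed
  qed
  then obtain l where l: "(\<lambda>n. u (real n)) \<longlonglongrightarrow> l" using Cauchy_convergent convergent_def by blast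
  have "norm (u t - l) \<le> D * exp (- k * t)" if "0 \<le> t" for t
  proof (rule tendsto_upperbound)
    show "(\<lambda>n. norm (u t - u (real n))) \<longlonglongrightarrow> norm (u t - l)" by (intro tendsto_intros l)
    have "\<forall>\<^sub>F n in sequentially. t < real n"
      using filterlim_real_sequentially by (simp add: filterlim_at_top_dense)
    thus "\<forall>\<^sub>F n in sequentially. norm (u t - u (real n)) \<le> D * exp (- k * t)"
      by eventually_elim (metis incr[OF that] norm_minus_commute)
  qed simp
  hence "\<forall>\<^sub>F t in at_top. norm (u t - l) \<le> D * exp (- k * t)"
    by (rule eventually_mono[OF eventually_ge_at_top])
  hence "((\<lambda>t. u t - l) \<longlongrightarrow> 0) at_top" by (rule Lim_null_comparison[OF _ lim])
  thus thesis using that by (simp add: LIM_zero_iff)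
qed

lemma global_gap_decay:
  assumes s: "s * s = 1" and tr: "trajectory {0..} r v" and pos: "0 < ang_mom s (r 0) (v 0)"
  obtains k C where "0 < k" "0 \<le> C" "\<And>t. 0 \<le> t \<Longrightarrow> gap s (r t) (v t) \<le> C * exp (- k * t)"
    "\<And>t. 0 \<le> t \<Longrightarrow> 0 < ang_mom s (r t) (v t)"
proof -
  have nonneg: "0 \<le> gap s (r 0) (v 0)" using gap_lower_bounds(3)[OF s pos] .
  obtain k C where k: "0 < k" and
    C: "\<And>T r' v'. \<lbrakk>trajectory {0..T} r' v'; 0 \<le> T; 0 < ang_mom s (r' 0) (v' 0);
        gap s (r' 0) (v' 0) \<le> gap s (r 0) (v 0)\<rbrakk> \<Longrightarrow> gap s (r' T) (v' T) \<le> C * exp (- k * T)"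
    using gap_exponential_decay[OF s nonneg] by blast
  have tr': "trajectory {0..T} r v" for T by (rule trajectory_subset[OF tr]) auto
  have decay: "gap s (r t) (v t) \<le> C * exp (- k * t)" if "0 \<le> t" for t
    using C[OF tr' that pos] by simp
  have "0 \<le> C" using decay[of 0] nonneg by simp
  moreover have "0 < ang_mom s (r t) (v t)" if "0 \<le> t" for t
    using ang_mom_sign_invariant[OF tr'[of t] _ _ pos, of t] that by simp
  ultimately show thesis using that[OF k _ decay] by blast
qed

lemma gap_tendsto_0:
  assumes "s * s = 1" "trajectory {0..} r v" "0 < ang_mom s (r 0) (v 0)"
  shows "((\<lambda>t. gap s (r t) (v t)) \<longlongrightarrow> 0) at_top"
proof -
  obtain k C where k: "0 < k" and "0 \<le> C"
    and d: "\<And>t. 0 \<le> t \<Longrightarrow> gap s (r t) (v t) \<le> C * exp (- k * t)"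
    and L: "\<And>t. 0 \<le> t \<Longrightarrow> 0 < ang_mom s (r t) (v t)"
    using global_gap_decay[OF assms] by blast
  show ?thesis
    by (rule tendsto_sandwich[OF _ _ tendsto_const exp_decay_tendsto[OF k, of C]])
      (use d gap_lower_bounds(3)[OF assms(1) L] in
        \<open>blast intro: eventually_mono[OF eventually_ge_at_top[of 0]]\<close>)+
qed

lemma convergence_to_rotation:
  assumes s: "s * s = 1" and tr: "trajectory {0..} r v" and pos: "0 < ang_mom s (r 0) (v 0)"
  shows "\<exists>\<theta>. ((\<lambda>t. r t - rotation s \<theta> t) \<longlongrightarrow> 0) at_top"
proof -
  obtain k C where k: "0 < k" and C: "0 \<le> C"
    and d: "\<And>t. 0 \<le> t \<Longrightarrow> gap s (r t) (v t) \<le> C * exp (- k * t)"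
    and L: "\<And>t. 0 \<le> t \<Longrightarrow> 0 < ang_mom s (r t) (v t)"
    using global_gap_decay[OF assms] by blast
  define u where "u t = r t * cis (- s * t)" for t
  define u' where "u' t = (v t - s *\<^sub>R (\<i> * r t)) * cis (- s * t)" for t
  have "(u has_vector_derivative u' t) (at t within {0..})" if "0 \<le> t" for t
  proof -
    have "(r has_vector_derivative v t) (at t within {0..})"
      using tr that by (simp add: trajectory_def)
    from has_vector_derivative_mult[OF this cis_has_vector_derivative[of "- s"]]
    show ?thesis unfolding u_def u'_def by (simp add: algebra_simps)
  qed
  moreover have "norm (u' t) \<le> sqrt C * exp (- (k / 2) * t)" if "0 \<le> t" for t
  proof -
    have "(norm (u' t))\<^sup>2 \<le> C * exp (- k * t)"
      using gap_lower_bounds(1)[OF s L[OF that]] d[OF that] by (simp add: u'_def norm_mult)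
    hence "norm (u' t) \<le> sqrt (C * exp (- k * t))" by (rule real_le_rsqrt)
    also have "exp (- k * t) = (exp (- (k / 2) * t))\<^sup>2"
      by (simp add: power2_eq_square flip: exp_add)
    finally show ?thesis by (simp add: real_sqrt_mult)
  qed
  moreover have "0 < k / 2" using k by simp
  ultimately obtain l where l: "(u \<longlongrightarrow> l) at_top"
    by (metis exponentially_bounded_derivative_converges)
  have "((\<lambda>t. 2 * sqrt (gap s (r t) (v t))) \<longlongrightarrow> 2 * sqrt 0) at_top"
    by (intro tendsto_intros gap_tendsto_0[OF assms])
  hence "((\<lambda>t. 2 * sqrt (gap s (r t) (v t))) \<longlongrightarrow> 0) at_top" by simp
  moreover have "norm (norm (u t) - 1) \<le> 2 * sqrt (gap s (r t) (v t))" if "0 \<le> t" for t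
    using norm_near_one[OF s L[OF that]] by (simp add: u_def norm_mult)
  hence "\<forall>\<^sub>F t in at_top. norm (norm (u t) - 1) \<le> 2 * sqrt (gap s (r t) (v t))"
    by (rule eventually_mono[OF eventually_ge_at_top])
  ultimately have "((\<lambda>t. norm (u t) - 1) \<longlongrightarrow> 0) at_top" by (rule Lim_null_comparison[rotated])
  hence "((\<lambda>t. norm (u t)) \<longlongrightarrow> 1) at_top" by (simp add: LIM_zero_iff)
  hence "norm l = 1" using tendsto_norm[OF l] tendsto_unique[OF trivial_limit_at_top_linorder] by blast
  hence l': "l = cis (Arg l)" using cis_Arg[of l] by (cases "l = 0") (auto simp: sgn_eq)
  have "((\<lambda>t. norm (u t - l)) \<longlongrightarrow> 0) at_top"
    using l by (intro tendsto_norm_zero) (simp add: LIM_zero_iff)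
  moreover have "norm (u t - l) = norm (r t - rotation s (Arg l) t)" for t
  proof -
    have "u t * cis (s * t) = r t" by (simp add: u_def cis_mult mult.assoc)
    hence "r t - rotation s (Arg l) t = (u t - l) * cis (s * t)"
      by (simp add: rotation_def l'[symmetric] left_diff_distrib)
    thus ?thesis by (simp add: norm_mult)
  qed
  ultimately show ?thesis by (auto simp: tendsto_norm_zero_iff)
qed

lemma convergence_from_positive_instant:
  assumes s: "s * s = 1" and sol: "solution {0..} r" and t: "0 \<le> t"
    and pos: "0 < ang_mom s (r t) (velocity {0..} r t)"
  shows "\<exists>\<theta>. ((\<lambda>t. r t - rotation s \<theta> t) \<longlongrightarrow> 0) at_top"
proof -
  have tr: "trajectory {0..} r (velocity {0..} r)" using sol by (simp add: solution_iff_trajectory)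
  hence "trajectory {0..t} r (velocity {0..} r)" by (rule trajectory_subset) auto
  from ang_mom_sign_invariant[OF this _ _ pos, of 0]
  have "0 < ang_mom s (r 0) (velocity {0..} r 0)" using t by simp
  thus ?thesis by (rule convergence_to_rotation[OF s tr])
qed

lemma sgn_Im_divide:
  fixes z w :: complex
  assumes "z \<noteq> 0"
  shows "0 < Im (w / z) \<longleftrightarrow> 0 < ang_mom 1 z w" "Im (w / z) < 0 \<longleftrightarrow> 0 < ang_mom (- 1) z w"
proof -
  have "Im (w / z) = ang_mom 1 z w / (norm z)\<^sup>2"
    by (simp add: Im_divide ang_mom_eq cmod_power2 algebra_simps)
  moreover have "0 < (norm z)\<^sup>2" using assms by simp
  moreover have "ang_mom (- 1) z w = - ang_mom 1 z w" by (simp add: ang_mom_def)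
  ultimately show "0 < Im (w / z) \<longleftrightarrow> 0 < ang_mom 1 z w" "Im (w / z) < 0 \<longleftrightarrow> 0 < ang_mom (- 1) z w"
    by (simp_all add: zero_less_divide_iff divide_less_0_iff)
qed

section \<open>Isolation and stability of the limit cycles\<close>

lemma trajectory_shift:
  assumes "trajectory UNIV r v"
  shows "trajectory UNIV (\<lambda>t. r (t + a)) (\<lambda>t. v (t + a))"
proof -
  have shift: "((\<lambda>t. f (t + a)) has_vector_derivative f') (at t)"
    if "(f has_vector_derivative f') (at (t + a))"
    for f :: "real \<Rightarrow> complex" and f' t
  proof -
    have "((\<lambda>t. t + a) has_vector_derivative 1) (at t)"
      by (auto intro!: derivative_eq_intros simp: has_vector_derivative_def)
    from vector_diff_chain_at[OF this that] show ?thesis by (simp add: o_def)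
  qed
  show ?thesis unfolding trajectory_def
  proof (intro ballI conjI)
    fix t
    have "(r has_vector_derivative v (t + a)) (at (t + a))"
      "(v has_vector_derivative (1 - (norm (v (t + a)))\<^sup>2) *\<^sub>R v (t + a) - r (t + a)) (at (t + a))"
      using assms by (auto simp only: trajectory_def)
    from this[THEN shift]
    show "((\<lambda>t. r (t + a)) has_vector_derivative v (t + a)) (at t)"
      "((\<lambda>t. v (t + a)) has_vector_derivative
         (1 - (norm (v (t + a)))\<^sup>2) *\<^sub>R v (t + a) - r (t + a)) (at t)" .
  qed
qed

text \<open>
  The gap at any instant \<open>t\<close> equals the gap at \<open>t + n T\<close>, which tends to zero, so it vanishes
  identically. Therefore \<open>v = s i q\<close> with \<open>|q| = 1\<close>, and \<open>q\<close> is one of the rotations.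
\<close>

lemma periodic_trajectory_orbit:
  assumes s: "s * s = 1" and q: "periodic_solution q"
    and pos: "0 < ang_mom s (q t0) (velocity UNIV q t0)"
  shows "orbit q = phase_circle s"
proof -
  define v where "v = velocity UNIV q"
  have tr: "trajectory UNIV q v"
    using q unfolding periodic_solution_def solution_iff_trajectory v_def by blast
  obtain T where T: "0 < T" and per: "\<And>t. q (t + T) = q t" using q unfolding periodic_solution_def by blast
  have "velocity UNIV (\<lambda>t. q (t + T)) = (\<lambda>t. v (t + T))"
    by (rule trajectory_velocity[OF trajectory_shift[OF tr]])
  hence perv: "v (t + T) = v t" for t unfolding per v_def by metis
  have pern: "q (t + real n * T) = q t \<and> v (t + real n * T) = v t" for t n
  proof (induction n)
    case (Suc n)
    thus ?case using per[of "t + real n * T"] perv[of "t + real n * T"] by (simp add: algebra_simps)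
  qed simp
  have L: "0 < ang_mom s (q t) (v t)" for t
  proof -
    \<comment> \<open>Restart at the earlier of the two instants, so that both lie in an interval starting at time \<open>0\<close>.\<close>
    define a where "a = min t t0"
    have "trajectory {0..\<bar>t - t0\<bar>} (\<lambda>x. q (x + a)) (\<lambda>x. v (x + a))"
      by (rule trajectory_subset[OF trajectory_shift[OF tr]]) simp
    from ang_mom_sign_invariant[OF this, of "t0 - a" "t - a" s] show ?thesis
      using pos by (auto simp: a_def min_def v_def)
  qed
  have gap0: "gap s (q t) (v t) = 0" for t
  proof -
    have "trajectory {0..} (\<lambda>x. q (x + t)) (\<lambda>x. v (x + t))"
      by (rule trajectory_subset[OF trajectory_shift[OF tr]]) simp
    from gap_tendsto_0[OF s this] L
    have "((\<lambda>x. gap s (q (x + t)) (v (x + t))) \<longlongrightarrow> 0) at_top" by simp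
    moreover have "filterlim (\<lambda>n. real n * T) at_top sequentially"
      using filterlim_at_top_mult_tendsto_pos[OF tendsto_const T filterlim_real_sequentially] .
    ultimately have "(\<lambda>n. gap s (q (real n * T + t)) (v (real n * T + t))) \<longlonglongrightarrow> 0"
      by (rule filterlim_compose)
    hence "(\<lambda>n::nat. gap s (q t) (v t)) \<longlonglongrightarrow> 0" using pern[of t] by (simp add: add.commute)
    thus ?thesis by (simp add: LIMSEQ_const_iff)
  qed
  have v: "v t = s *\<^sub>R (\<i> * q t)" for t
    using gap_lower_bounds(1)[OF s L[of t]] gap0[of t] by simp
  have n: "norm (q t) = 1" for t using norm_near_one[OF s L[of t]] gap0[of t] by simp
  have "((\<lambda>t. q t * cis (- s * t)) has_vector_derivative 0) (at t)" for t
  proof -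
    have "(q has_vector_derivative v t) (at t)" using tr by (simp add: trajectory_def)
    from has_vector_derivative_mult[OF this cis_has_vector_derivative[of "- s"]]
    show ?thesis by (simp add: v algebra_simps)
  qed
  then obtain c where c: "\<And>t. q t * cis (- s * t) = c"
    using has_vector_derivative_zero_constant[of UNIV "\<lambda>t. q t * cis (- s * t)"] by auto
  have q_eq: "q t = c * cis (s * t)" for t unfolding c[of t, symmetric] by (simp add: cis_mult mult.assoc)
  have "norm c = 1" using n[of 0] c[of 0] by simp
  hence "c = cis (Arg c)" using cis_Arg[of c] by (cases "c = 0") (auto simp: sgn_eq)
  hence "q = rotation s (Arg c)" using q_eq by (auto simp: rotation_def fun_eq_iff)
  thus ?thesis using rotation_orbit[OF s] by simp
qed

lemma rotation_limit_cycle: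
  assumes s: "s * s = 1"
  shows "limit_cycle (rotation s \<theta>)"
  unfolding limit_cycle_def rotation_orbit[OF s]
proof (intro conjI exI[of _ "1 / 6"] allI impI)
  show "periodic_solution (rotation s \<theta>)" by (rule rotation_periodic_solution[OF s])
next
  fix q assume q: "periodic_solution q" "\<exists>t. infdist (state UNIV q t) (phase_circle s) < 1 / 6"
  then obtain t where "infdist (q t, velocity UNIV q t) (phase_circle s) < 1 / 6"
    by (auto simp: state_def)
  from near_phase_circle(1)[OF s this] show "orbit q = phase_circle s"
    using periodic_trajectory_orbit[OF s q(1)] by simp
qed simp

lemma rotation_orbitally_stable:
  assumes s: "s * s = 1"
  shows "orbitally_stable (rotation s \<theta>)"
  unfolding orbitally_stable_def rotation_orbit[OF s]
proof (intro allI impI)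
  fix \<epsilon> :: real assume \<epsilon>: "0 < \<epsilon>"
  \<comment> \<open>An initial distance below \<open>\<delta>\<close> gives gap at most \<open>40 * \<delta>^2\<close> at all later times, hence
      distance at most \<open>5 * 7 * \<delta> < \<epsilon>\<close>.\<close>
  define \<delta> where "\<delta> = min (1 / 6) (\<epsilon> / 40)"
  have \<delta>: "0 < \<delta>" "\<delta> \<le> 1 / 6" "\<delta> \<le> \<epsilon> / 40" using \<epsilon> by (auto simp: \<delta>_def)
  show "\<exists>\<delta>>0. \<forall>T>0. \<forall>r. solution {0..T} r \<longrightarrow>
      infdist (state {0..T} r 0) (phase_circle s) < \<delta> \<longrightarrow>
      (\<forall>t\<in>{0..T}. infdist (state {0..T} r t) (phase_circle s) < \<epsilon>)"
  proof (intro exI[of _ \<delta>] conjI \<delta>(1) allI impI ballI)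
    fix T r t
    define v where "v = velocity {0..T} r"
    assume "0 < T" "solution {0..T} r" and t: "t \<in> {0..T}"
      and "infdist (state {0..T} r 0) (phase_circle s) < \<delta>"
    hence tr: "trajectory {0..T} r v" and near: "infdist (r 0, v 0) (phase_circle s) < \<delta>"
      by (auto simp: solution_iff_trajectory state_def v_def)
    note start = near_phase_circle[OF s near \<delta>(2)]
    have tr': "trajectory {0..t} r v" by (rule trajectory_subset[OF tr]) (use t in auto)
    have "0 < ang_mom s (r t) (v t)"
      using ang_mom_sign_invariant[OF tr' _ _ start(1), of t] t by simp
    hence "infdist (r t, v t) (phase_circle s) \<le> 5 * sqrt (gap s (r t) (v t))"
      by (rule infdist_phase_circle_le[OF s])
    also have "gap s (r t) (v t) \<le> 40 * \<delta>\<^sup>2"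
      using gap_nonincreasing[OF tr' _ start(1)] start(2) t by simp
    also have "40 * \<delta>\<^sup>2 \<le> (7 * \<delta>)\<^sup>2" by (simp add: power_mult_distrib)
    also have "sqrt ((7 * \<delta>)\<^sup>2) = 7 * \<delta>" by (rule real_sqrt_unique) (use \<delta> in auto)
    also have "5 * (7 * \<delta>) < \<epsilon>" using \<delta> \<epsilon> by simp
    finally show "infdist (state {0..T} r t) (phase_circle s) < \<epsilon>"
      by (simp add: state_def v_def)
  qed
qed

lemma rotation_orbitally_attracting:
  assumes s: "s * s = 1"
  shows "orbitally_attracting (rotation s \<theta>)"
  unfolding orbitally_attracting_def rotation_orbit[OF s]
proof (intro exI[of _ "1 / 6"] conjI allI impI)
  fix r
  define v where "v = velocity {0..} r"
  assume "solution {0..} r" "infdist (state {0..} r 0) (phase_circle s) < 1 / 6"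
  hence tr: "trajectory {0..} r v" and near: "infdist (r 0, v 0) (phase_circle s) < 1 / 6"
    by (auto simp: solution_iff_trajectory state_def v_def)
  have pos: "0 < ang_mom s (r 0) (v 0)" by (rule near_phase_circle(1)[OF s near]) simp
  have L: "0 < ang_mom s (r t) (v t)" if "0 \<le> t" for t
    using global_gap_decay[OF s tr pos] that by metis
  have "((\<lambda>t. 5 * sqrt (gap s (r t) (v t))) \<longlongrightarrow> 5 * sqrt 0) at_top"
    by (intro tendsto_intros gap_tendsto_0[OF s tr pos])
  hence "((\<lambda>t. 5 * sqrt (gap s (r t) (v t))) \<longlongrightarrow> 0) at_top" by simp
  thus "((\<lambda>t. infdist (state {0..} r t) (phase_circle s)) \<longlongrightarrow> 0) at_top"
    by (rule tendsto_sandwich[rotated 3, where f = "\<lambda>_. 0"])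
      (auto simp: state_def infdist_nonneg v_def[symmetric]
        intro!: eventually_mono[OF eventually_ge_at_top[of 0]] infdist_phase_circle_le[OF s L])
qed simp

lemma rotation_stable_limit_cycle:
  "s * s = 1 \<Longrightarrow> stable_limit_cycle (rotation s \<theta>)"
  by (simp add: stable_limit_cycle_def rotation_limit_cycle rotation_orbitally_stable
      rotation_orbitally_attracting)

lemma r_plus_eq: "r_plus \<theta> = rotation 1 \<theta>" and r_minus_eq: "r_minus \<theta> = rotation (- 1) \<theta>"
  by (auto simp: r_plus_def r_minus_def rotation_def fun_eq_iff)

theorem theorem1p3:
  "(\<forall>r. solution {0..} r \<longrightarrow>
      ((\<exists>t\<ge>0. r t \<noteq> 0 \<and> velocity {0..} r t \<noteq> 0 \<and>
          0 < angle_from_to (r t) (velocity {0..} r t) \<and>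
          angle_from_to (r t) (velocity {0..} r t) < pi) \<longrightarrow>
        (\<exists>\<theta>. ((\<lambda>t. r t - r_plus \<theta> t) \<longlongrightarrow> 0) at_top)) \<and>
      ((\<exists>t\<ge>0. r t \<noteq> 0 \<and> velocity {0..} r t \<noteq> 0 \<and>
          - pi < angle_from_to (r t) (velocity {0..} r t) \<and>
          angle_from_to (r t) (velocity {0..} r t) < 0) \<longrightarrow>
        (\<exists>\<theta>. ((\<lambda>t. r t - r_minus \<theta> t) \<longlongrightarrow> 0) at_top))) \<and>
   (\<forall>\<theta>. stable_limit_cycle (r_plus \<theta>) \<and> stable_limit_cycle (r_minus \<theta>))"
proof (intro conjI allI impI)
  fix r
  assume sol: "solution {0..} r"
    and "\<exists>t\<ge>0. r t \<noteq> 0 \<and> velocity {0..} r t \<noteq> 0 \<and>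
      0 < angle_from_to (r t) (velocity {0..} r t) \<and>
      angle_from_to (r t) (velocity {0..} r t) < pi"
  then obtain t where "0 \<le> t" "0 < ang_mom 1 (r t) (velocity {0..} r t)"
    unfolding angle_from_to_def by (auto simp: Arg_lt_pi sgn_Im_divide(1))
  from convergence_from_positive_instant[OF _ sol this]
  show "\<exists>\<theta>. ((\<lambda>t. r t - r_plus \<theta> t) \<longlongrightarrow> 0) at_top" by (simp add: r_plus_eq)
next
  fix r
  assume sol: "solution {0..} r"
    and "\<exists>t\<ge>0. r t \<noteq> 0 \<and> velocity {0..} r t \<noteq> 0 \<and>
      - pi < angle_from_to (r t) (velocity {0..} r t) \<and>
      angle_from_to (r t) (velocity {0..} r t) < 0"
  then obtain t where "0 \<le> t" "r t \<noteq> 0" "Im (velocity {0..} r t / r t) < 0"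
    unfolding angle_from_to_def using Arg_less_0 by (metis not_le)
  hence "0 \<le> t" "0 < ang_mom (- 1) (r t) (velocity {0..} r t)"
    by (auto simp: sgn_Im_divide(2))
  from convergence_from_positive_instant[OF _ sol this]
  show "\<exists>\<theta>. ((\<lambda>t. r t - r_minus \<theta> t) \<longlongrightarrow> 0) at_top" by (simp add: r_minus_eq)
qed (simp_all add: r_plus_eq r_minus_eq rotation_stable_limit_cycle)

end
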